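(* Let $U(x,y,z)$ be the generating function in which the coefficient of $x^ry^dz^n$ is the number of Dyck paths of semilength $n$ whose $r$th up-step has height $d$ (for $1\le r\le n$). Then $$U(x,y,z)=\frac{xyzC(z)^2}{1-xz\left(yC(z)+C(xz)\right)}=\frac{xyzC(z)^2C(xz)}{1-xyzC(z)C(xz)}.$$
   Context: A Dyck path of semilength $n$ is a lattice path in $\mathbb Z^2$ with up-steps $(1,1)$ and down-steps $(1,-1)$ that starts at $(0,0)$, ends at $(2n,0)$, and never goes below the $x$-axis. The height of a step is the $y$-coordinate of its highest point. The up-steps of a path of semilength $n$ are indexed $1,\dots,n$ from left to right. $C(z)=\sum_{n\ge0}\frac{1}{n+1}\binom{2n}{n}z^n=\frac{1-\sqrt{1-4z}}{2z}$ is the Catalan generating function. *)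

theory Defs
  imports
    "HOL-Computational_Algebra.Formal_Power_Series"
    "HOL-Library.Product_Plus"
begin

unbundle fps_syntax

section \<open>Dyck paths\<close>

datatype step = Up | Down

fun step_vec :: "step \<Rightarrow> int \<times> int" where
  "step_vec Up = (1, 1)"
| "step_vec Down = (1, -1)"

text \<open>The lattice point reached after the first \<open>k\<close> steps, starting from the origin.\<close>

definition path_point :: "step list \<Rightarrow> nat \<Rightarrow> int \<times> int" where
  "path_point w k = (\<Sum>s\<leftarrow>take k w. step_vec s)"

definition dyck_path :: "nat \<Rightarrow> step list \<Rightarrow> bool" where
  "dyck_path n w \<longleftrightarrow>
     path_point w (length w) = (2 * int n, 0) \<and>
     (\<forall>k\<le>length w. 0 \<le> snd (path_point w k))"

text \<open>
  Positions in \<open>w\<close> count from \<open>0\<close>; the step at position \<open>i\<close> joins \<open>path_point w i\<close>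
  to \<open>path_point w (Suc i)\<close>.
\<close>

definition step_height :: "step list \<Rightarrow> nat \<Rightarrow> int" where
  "step_height w i = max (snd (path_point w i)) (snd (path_point w (Suc i)))"

text \<open>Up-steps are indexed from \<open>1\<close>, so \<open>r\<close> is meaningful when it lies between \<open>1\<close> and the
  number of up-steps.\<close>

definition up_step_pos :: "step list \<Rightarrow> nat \<Rightarrow> nat" where
  "up_step_pos w r = filter (\<lambda>i. w ! i = Up) [0..<length w] ! (r - 1)"

definition up_step_count :: "nat \<Rightarrow> nat \<Rightarrow> nat \<Rightarrow> nat" where
  "up_step_count r d n =
     card {w. dyck_path n w \<and> step_height w (up_step_pos w r) = int d}"


section \<open>Power series in three variables\<close>

text \<open>
  Series in \<open>x\<close>, \<open>y\<close>, \<open>z\<close> are nested: the outermost variable is \<open>z\<close>, then \<open>y\<close>, then \<open>x\<close>,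
  so the coefficient of \<open>x\<^sup>r y\<^sup>d z\<^sup>n\<close> in \<open>F\<close> is \<open>F $ n $ d $ r\<close>.
\<close>

type_synonym fps3 = "rat fps fps fps"

definition X :: fps3 where "X = fps_const (fps_const fps_X)"
definition Y :: fps3 where "Y = fps_const fps_X"
definition Z :: fps3 where "Z = fps_X"

definition catalan_gf :: "rat fps" where
  "catalan_gf = Abs_fps (\<lambda>n. 1 / (of_nat n + 1) * of_nat ((2 * n) choose n))"

text \<open>
  The Catalan series evaluated at a series \<open>t\<close>. Composition is taken in the outermost variable,
  so \<open>t\<close> has to be divisible by \<open>Z\<close>.
\<close>

definition C :: "fps3 \<Rightarrow> fps3" where
  "C t = Abs_fps (\<lambda>n. fps_const (fps_const (catalan_gf $ n))) oo t"

definition U :: fps3 where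
  "U = Abs_fps (\<lambda>n. Abs_fps (\<lambda>d. Abs_fps (\<lambda>r.
         if 1 \<le> r \<and> r \<le> n then of_nat (up_step_count r d n) else 0)))"

text \<open>
  The coefficient ring \<open>rat fps fps\<close> is not a field, so the library facts about quotients of
  power series over fields do not apply here. Division is nevertheless the
  true quotient whenever the denominator has constant term \<open>1\<close> as a series in \<open>z\<close>.
\<close>

lemma fps3_divide_eq_iff:
  fixes f g h :: fps3
  assumes "g $ 0 = 1"
  shows "f / g = h \<longleftrightarrow> f = h * g"
proof -
  have inv1: "inverse (1 :: rat fps fps) = 1"
    by (intro fps_inverse_one') simp
  have inv: "g * inverse g = 1"
    unfolding fps_inverse_def[of g]
    by (rule fps_right_inverse) (simp only: assms inv1 mult_1_left)
  have div: "f / g = f * inverse g"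
    by (rule fps_divide_unit) (simp add: assms)
  have "f * inverse g * g = f"
    by (simp only: mult.assoc mult.commute[of "inverse g"] inv mult_1_right)
  moreover have "h * g * inverse g = h"
    by (simp only: mult.assoc inv mult_1_right)
  ultimately show ?thesis
    unfolding div by metis
qed

end

theory Submission
  imports Defs
begin

text \<open>
  Cut a Dyck path \<open>w\<close> of semilength \<open>n\<close> at its \<open>r\<close>th up-step, \<open>w = u @ Up # v\<close>. That step has
  height \<open>d\<close> exactly when the non-negative walk \<open>u\<close>, which has \<open>r - 1\<close> up-steps, ends at height
  \<open>d - 1\<close>; then \<open>v\<close> is an arbitrary non-negative walk from \<open>d\<close> to \<open>0\<close> with \<open>n - r\<close> up-steps. So the
  coefficient of \<open>x\<^sup>r y\<^sup>d z\<^sup>n\<close> is a product of two numbers of walks (\<open>up_step_count_Suc\<close>).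

  Counted by up-steps, the walks from \<open>d\<close> to \<open>0\<close> have the generating function \<open>C(z)\<^bsup>d+1\<^esup>\<close>
  (\<open>card_walks_to_0\<close>): removing the first step gives the recurrence that the relation
  \<open>C = 1 + z C\<^sup>2\<close> gives for the powers of \<open>C\<close>. A walk from \<open>0\<close> to \<open>d\<close>, read backwards, is a walk
  from \<open>d\<close> to \<open>0\<close> with \<open>d\<close> fewer up-steps, so these have \<open>z\<^sup>d C(z)\<^bsup>d+1\<^esup>\<close> (\<open>card_walks_from_0\<close>).

  The up-steps up to and including the \<open>r\<close>th one carry the weight \<open>x z\<close>, the later ones the weight
  \<open>z\<close>. Hence, for \<open>d \<ge> 1\<close>, the coefficient of \<open>y\<^sup>d\<close> in \<open>U\<close> is
  \<open>(x z)\<^sup>d C(x z)\<^sup>d C(z)\<^bsup>d+1\<^esup>\<close> (\<open>y_coeff_U_Suc\<close>). These coefficients form a geometric progression,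
  which \<open>U_eq\<close> expresses as a linear equation for \<open>U\<close>. It gives the second quotient; the first one
  arises by cancelling the factor \<open>C(x z)\<close>, because
  \<open>C(x z) (1 - x z (y C(z) + C(x z))) = 1 - x y z C(z) C(x z)\<close> by the quadratic relation for
  \<open>C(x z)\<close>.
\<close>

section \<open>The quadratic equation of the Catalan series\<close>

text \<open>
  The differential equation is a first-order recurrence for the coefficients, and the factor
  \<open>4 * n - 4\<close> in it vanishes at \<open>n = 1\<close>, which ends the series after the linear term.
\<close>

lemma fps_eq_one_minus_4X:
  fixes h :: "rat fps"
  assumes ode: "(1 - 4 * fps_X) * fps_deriv h = - 4 * h" and h0: "h $ 0 = 1"
  shows "h = 1 - 4 * fps_X"
proof -
  have rec: "of_nat (Suc n) * h $ Suc n = (4 * of_nat n - 4) * h $ n" for n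
  proof -
    have "((1 - 4 * fps_X) * fps_deriv h) $ n = (- 4 * h) $ n"
      using ode by simp
    then show ?thesis
      by (cases n) (simp_all add: algebra_simps numeral_fps_const)
  qed
  have h1: "h $ 1 = - 4"
    using rec[of 0] h0 by simp
  have h2: "h $ Suc (Suc n) = 0" for n
  proof (induction n)
    case 0
    show ?case using rec[of 1] by simp
  next
    case (Suc n)
    have "of_nat (Suc (Suc (Suc n))) * h $ Suc (Suc (Suc n)) = 0"
      using rec[of "Suc (Suc n)"] Suc by simp
    then show ?case
      by (simp only: mult_eq_0_iff of_nat_eq_0_iff) simp
  qed
  show ?thesis
  proof (rule fps_ext)
    fix n
    consider "n = 0" | "n = 1" | m where "n = Suc (Suc m)"
      by (metis One_nat_def not0_implies_Suc)
    then show "h $ n = (1 - 4 * fps_X) $ n"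
      by cases (use h0 h1 h2 in \<open>simp_all add: numeral_fps_const\<close>)
  qed
qed

lemma central_binomial_Suc:
  "Suc n * ((2 * Suc n) choose Suc n) = (4 * n + 2) * ((2 * n) choose n)"
proof -
  have "Suc n * ((2 * Suc n) choose Suc n) = 2 * Suc n * (Suc (2 * n) choose Suc n)"
    using Suc_times_binomial_eq[of "Suc (2 * n)" n] binomial_symmetric[of n "Suc (2 * n)"]
    by (simp del: binomial_Suc_Suc)
  also have "\<dots> = 2 * (Suc (2 * n) * ((2 * n) choose n))"
    by (simp only: Suc_times_binomial_eq) (simp only: mult_ac)
  finally show ?thesis
    by simp
qed

lemma catalan_gf_rec:
  "of_nat (n + 2) * catalan_gf $ Suc n = of_nat (4 * n + 2) * catalan_gf $ n"
proof -
  have eq: "of_nat (Suc n) * of_nat ((2 * Suc n) choose Suc n)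
      = (of_nat (4 * n + 2) * of_nat ((2 * n) choose n) :: rat)"
    by (simp only: of_nat_mult[symmetric] central_binomial_Suc)
  have nz: "of_nat n + 1 \<noteq> (0::rat)" "of_nat n + 2 \<noteq> (0::rat)"
    by (metis of_nat_Suc of_nat_neq_0 add.commute)
       (metis add_2_eq_Suc' of_nat_add of_nat_neq_0 of_nat_numeral)
  have "of_nat (n + 2) * catalan_gf $ Suc n = (of_nat ((2 * Suc n) choose Suc n) :: rat)"
    using nz by (simp add: catalan_gf_def field_simps)
  also have "\<dots> = of_nat (4 * n + 2) * of_nat ((2 * n) choose n) / of_nat (Suc n)"
    using eq nz by (simp add: field_simps)
  also have "\<dots> = of_nat (4 * n + 2) * catalan_gf $ n"
    using nz by (simp add: catalan_gf_def field_simps)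
  finally show ?thesis .
qed

text \<open>
  The closed form suggests that \<open>g = 1 - 2 z C(z)\<close> is the square root of \<open>1 - 4 z\<close>. The recurrence
  of the Catalan numbers says that \<open>g\<close> solves \<open>(1 - 4 z) g' = -2 g\<close>, as that square root does, so
  \<open>g\<^sup>2\<close> satisfies the equation whose only solution with constant term \<open>1\<close> is \<open>1 - 4 z\<close>.
  Expanding \<open>g\<^sup>2 = 1 - 4 z\<close> gives the claim.
\<close>

lemma catalan_gf_eq: "catalan_gf = 1 + fps_X * catalan_gf ^ 2"
proof -
  define g where "g = 1 - 2 * fps_X * catalan_gf"
  have g_Suc: "g $ Suc n = - 2 * catalan_gf $ n" for n
    by (simp add: g_def numeral_fps_const mult.assoc)
  have g0: "g $ 0 = 1"
    by (simp add: g_def)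
  have cat0: "catalan_gf $ 0 = 1"
    by (simp add: catalan_gf_def)
  have g_rec: "of_nat (Suc n) * g $ Suc n = (4 * of_nat n - 2) * g $ n" for n
  proof (cases n)
    case 0
    then show ?thesis using g_Suc[of 0] g0 cat0 by simp
  next
    case (Suc m)
    then show ?thesis
      using catalan_gf_rec[of m] g_Suc[of m] g_Suc[of "Suc m"] by (simp add: algebra_simps)
  qed
  have g_ode: "(1 - 4 * fps_X) * fps_deriv g = - 2 * g"
  proof (rule fps_ext)
    fix n
    show "((1 - 4 * fps_X) * fps_deriv g) $ n = (- 2 * g) $ n"
      using g_rec[of n] by (cases n) (simp_all add: algebra_simps numeral_fps_const)
  qed
  have "(1 - 4 * fps_X) * fps_deriv (g ^ 2) = 2 * g * ((1 - 4 * fps_X) * fps_deriv g)"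
    by (simp add: power2_eq_square algebra_simps)
  also have "\<dots> = - 4 * g ^ 2"
    unfolding g_ode by (simp add: power2_eq_square)
  finally have "g ^ 2 = 1 - 4 * fps_X"
    by (rule fps_eq_one_minus_4X) (simp add: g0 power2_eq_square)
  then have "4 * fps_X * catalan_gf = 4 * fps_X * (1 + fps_X * catalan_gf ^ 2)"
    unfolding g_def by (simp add: power2_eq_square algebra_simps)
  then show ?thesis
    by (simp only: mult_cancel_left) simp
qed

section \<open>Counting non-negative walks\<close>

text \<open>
  The walk starts at height \<open>h\<close>, ends at height \<open>k\<close> and never becomes negative. The start is a
  parameter because both pieces of a Dyck path cut at a step have to be described, and the
  recursion over the list matches the removal of the first step.
\<close>

fun walk :: "nat \<Rightarrow> step list \<Rightarrow> nat \<Rightarrow> bool" where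
  "walk h [] k \<longleftrightarrow> h = k"
| "walk h (Up # w) k \<longleftrightarrow> walk (Suc h) w k"
| "walk h (Down # w) k \<longleftrightarrow> h > 0 \<and> walk (h - 1) w k"

lemma walk_append: "walk h (u @ v) k \<longleftrightarrow> (\<exists>m. walk h u m \<and> walk m v k)"
  by (induction h u k rule: walk.induct) auto

lemma path_point_Nil [simp]: "path_point [] k = (0, 0)"
  by (simp add: path_point_def zero_prod_def)

lemma path_point_0 [simp]: "path_point w 0 = (0, 0)"
  by (simp add: path_point_def zero_prod_def)

lemma path_point_Cons_Suc [simp]: "path_point (s # w) (Suc k) = step_vec s + path_point w k"
  by (simp add: path_point_def)

lemma path_point_append_le: "k \<le> length u \<Longrightarrow> path_point (u @ v) k = path_point u k"
  by (simp add: path_point_def)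

lemma walk_iff_path_point:
  "walk h w k \<longleftrightarrow>
     (\<forall>j\<le>length w. 0 \<le> int h + snd (path_point w j)) \<and>
     int h + snd (path_point w (length w)) = int k"
proof (induction w arbitrary: h)
  case Nil
  then show ?case by simp
next
  case (Cons s w)
  have all: "(\<forall>j\<le>length (s # w). 0 \<le> int h + snd (path_point (s # w) j)) \<longleftrightarrow>
      (\<forall>j\<le>length w. 0 \<le> int h + snd (step_vec s) + snd (path_point w j))"
    by (simp add: All_less_Suc2 flip: less_Suc_eq_le) (simp add: add.assoc)
  show ?case
  proof (cases s)
    case Up
    then show ?thesis
      unfolding all by (simp add: Cons.IH algebra_simps)
  next
    case Down
    show ?thesis
    proof (cases h)
      case 0
      then have "\<not> (\<forall>j\<le>length w. 0 \<le> int h + snd (step_vec s) + snd (path_point w j))"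
        using Down by (auto intro!: exI[of _ 0])
      then show ?thesis
        using 0 Down unfolding all by simp
    next
      case (Suc h')
      then show ?thesis
        unfolding all using Down by (simp add: Cons.IH algebra_simps)
    qed
  qed
qed

lemma path_point_length:
  "path_point w (length w)
     = (int (count_list w Up) + int (count_list w Down), int (count_list w Up) - int (count_list w Down))"
proof (induction w)
  case (Cons s w)
  then show ?case by (cases s) auto
qed simp

lemma walk_count:
  assumes "walk h w k"
  shows "h + count_list w Up = k + count_list w Down"
  using assms by (simp add: walk_iff_path_point path_point_length)

text \<open>
  The first coordinate of the end point is the number of steps and the second one is the surplus of
  up-steps; together they make \<open>n\<close> the number of up-steps.
\<close>

lemma dyck_path_iff_walk: "dyck_path n w \<longleftrightarrow> walk 0 w 0 \<and> count_list w Up = n"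
  unfolding dyck_path_def walk_iff_path_point by (auto simp: path_point_length)

definition walks :: "nat \<Rightarrow> nat \<Rightarrow> nat \<Rightarrow> step list set" where
  "walks h a k = {w. walk h w k \<and> count_list w Up = a}"

lemma length_eq_count: "length w = count_list w Up + count_list w Down"
proof (induction w)
  case (Cons s w)
  then show ?case by (cases s) auto
qed simp

lemma finite_walks: "finite (walks h a k)"
proof (rule finite_subset)
  show "walks h a k \<subseteq> {w. set w \<subseteq> {Up, Down} \<and> length w \<le> h + a + a}"
  proof
    fix w assume "w \<in> walks h a k"
    then have "walk h w k" "count_list w Up = a"
      by (auto simp: walks_def)
    moreover have "set w \<subseteq> {Up, Down}"
      using step.exhaust by auto
    ultimately show "w \<in> {w. set w \<subseteq> {Up, Down} \<and> length w \<le> h + a + a}"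
      using walk_count[of h w k] length_eq_count[of w] by simp
  qed
  show "finite {w. set w \<subseteq> {Up, Down} \<and> length w \<le> h + a + a}"
    by (rule finite_lists_length_le) simp
qed

text \<open>
  Classification by the first step: the walk is empty, goes up and uses one up-step, or goes down
  and uses none.
\<close>

lemma card_walks_to_0_rec:
  "card (walks d b 0) = of_bool (d = 0 \<and> b = 0)
     + (if b = 0 then 0 else card (walks (Suc d) (b - 1) 0))
     + (if d = 0 then 0 else card (walks (d - 1) b 0))"
proof -
  let ?N = "{w :: step list. w = [] \<and> d = 0 \<and> b = 0}"
  let ?U = "if b = 0 then {} else (#) Up ` walks (Suc d) (b - 1) 0"
  let ?D = "if d = 0 then {} else (#) Down ` walks (d - 1) b 0"
  have split: "walks d b 0 = ?N \<union> ?U \<union> ?D"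
  proof (rule set_eqI)
    fix w
    show "w \<in> walks d b 0 \<longleftrightarrow> w \<in> ?N \<union> ?U \<union> ?D"
    proof (cases w)
      case Nil
      then show ?thesis by (auto simp: walks_def)
    next
      case (Cons s v)
      then show ?thesis by (cases s) (auto simp: walks_def)
    qed
  qed
  have "card (walks d b 0) = card ?N + card ?U + card ?D"
    unfolding split
    by (subst card_Un_disjoint; (subst card_Un_disjoint)?) (auto simp: finite_walks)
  then show ?thesis
    by (simp add: card_image)
qed

text \<open>
  Multiplying \<open>C = 1 + z C\<^sup>2\<close> by \<open>C\<^sup>d\<close> shows that the coefficients of the powers of \<open>C\<close> obey the
  recurrence for the numbers of walks. The recurrence determines its solution because each step
  lowers the pair \<open>(b, d)\<close> lexicographically: an up-step lowers \<open>b\<close>, a down-step keeps \<open>b\<close> and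
  lowers \<open>d\<close>.
\<close>

lemma card_walks_to_0: "of_nat (card (walks d b 0)) = (catalan_gf ^ Suc d) $ b"
proof (induction b arbitrary: d rule: less_induct)
  case (less b)
  show ?case
  proof (induction d)
    have rec: "catalan_gf ^ Suc d $ b = catalan_gf ^ d $ b
        + (if b = 0 then 0 else catalan_gf ^ Suc (Suc d) $ (b - 1))" for d
    proof -
      have "catalan_gf ^ Suc d = catalan_gf ^ d * (1 + fps_X * catalan_gf ^ 2)"
        using catalan_gf_eq by simp
      also have "\<dots> = catalan_gf ^ d + fps_X * catalan_gf ^ Suc (Suc d)"
        by (simp add: algebra_simps power2_eq_square)
      finally show ?thesis
        by (simp only: fps_add_nth fps_X_mult_nth)
    qed
    {
      case 0
      show ?case
        using less.IH[of "b - 1" 1] unfolding rec[of 0]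
        by (subst card_walks_to_0_rec) (auto simp del: power_Suc)
    next
      case (Suc d)
      then show ?case
        using less.IH[of "b - 1" "Suc (Suc d)"] unfolding rec[of "Suc d"]
        by (subst card_walks_to_0_rec) (auto simp del: power_Suc)
    }
  qed
qed

fun flip :: "step \<Rightarrow> step" where
  "flip Up = Down"
| "flip Down = Up"

lemma flip_flip [simp]: "flip (flip s) = s"
  by (cases s) auto

abbreviation mirror :: "step list \<Rightarrow> step list" where
  "mirror w \<equiv> rev (map flip w)"

lemma mirror_mirror [simp]: "mirror (mirror w) = w"
  by (simp add: rev_map comp_def)

lemma walk_mirror: "walk k (mirror w) h" if "walk h w k"
  using that by (induction h w k rule: walk.induct) (auto simp: walk_append)

lemma count_Up_map_flip: "count_list (map flip w) Up = count_list w Down"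
proof (induction w)
  case (Cons s w)
  then show ?case by (cases s) auto
qed simp

lemma mirror_in_walks:
  assumes "w \<in> walks h a k" "h + a = k + b"
  shows "mirror w \<in> walks k b h"
  using assms walk_mirror[of h w k] walk_count[of h w k]
  by (simp add: walks_def count_Up_map_flip)

text \<open>
  Reading a walk backwards exchanges its ends and its two kinds of steps, so the walks from \<open>0\<close> to
  \<open>d\<close> with \<open>a\<close> up-steps, and hence \<open>a - d\<close> down-steps, correspond to the walks from \<open>d\<close> to \<open>0\<close> with
  \<open>a - d\<close> up-steps. If \<open>a < d\<close>, there are none.
\<close>

lemma card_walks_from_0:
  "of_nat (card (walks 0 a d)) = (fps_X ^ d * catalan_gf ^ Suc d) $ a"
proof (cases "a < d")
  case True
  then have "walks 0 a d = {}"
    using walk_count by (fastforce simp: walks_def)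
  then show ?thesis
    using True by (simp add: fps_X_power_mult_nth del: power_Suc)
next
  case False
  have "bij_betw mirror (walks 0 a d) (walks d (a - d) 0)"
  proof (rule bij_betw_byWitness[where f' = mirror])
    show "mirror ` walks 0 a d \<subseteq> walks d (a - d) 0"
      using False by (auto intro!: mirror_in_walks)
    show "mirror ` walks d (a - d) 0 \<subseteq> walks 0 a d"
      using False by (auto intro!: mirror_in_walks)
  qed simp_all
  then have "card (walks 0 a d) = card (walks d (a - d) 0)"
    by (rule bij_betw_same_card)
  then show ?thesis
    using False by (simp add: fps_X_power_mult_nth card_walks_to_0 del: power_Suc)
qed

section \<open>Cutting a Dyck path at an up-step\<close>

lemma up_step_pos_append:
  "up_step_pos (u @ Up # v) (Suc (count_list u Up)) = length u"
proof -
  have upt: "[0..<length (u @ Up # v)]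
      = [0..<length u] @ length u # [Suc (length u)..<length (u @ Up # v)]"
    using upt_add_eq_append[of 0 "length u" "Suc (length v)"] by (simp add: upt_conv_Cons del: upt_Suc)
  have "filter (\<lambda>i. (u @ Up # v) ! i = Up) [0..<length u] = filter (\<lambda>i. u ! i = Up) [0..<length u]"
    by (rule filter_cong) (auto simp: nth_append)
  moreover have "length (filter (\<lambda>i. u ! i = Up) [0..<length u]) = count_list u Up"
  proof -
    have "length (filter (\<lambda>i. u ! i = Up) [0..<length u])
        = length (filter ((=) Up) (map ((!) u) [0..<length u]))"
      by (simp add: filter_map comp_def eq_commute[of Up])
    also have "\<dots> = count_list u Up"
      by (simp only: map_nth count_list_eq_length_filter)
    finally show ?thesis .
  qed
  ultimately show ?thesis
    unfolding up_step_pos_def upt filter_append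
    by (simp add: nth_append)
qed

lemma split_at_up_step:
  assumes "i < count_list w Up"
  obtains u v where "w = u @ Up # v" "count_list u Up = i"
proof -
  have "\<exists>u v. w = u @ Up # v \<and> count_list u Up = i"
    using assms
  proof (induction w arbitrary: i)
    case (Cons s w)
    show ?case
    proof (cases "s = Up \<and> i = 0")
      case True
      then show ?thesis by (intro exI[of _ "[]"] exI[of _ w]) auto
    next
      case False
      define j where "j = (if s = Up then i - 1 else i)"
      have "j < count_list w Up"
        using False Cons.prems by (auto simp: j_def split: if_splits)
      then obtain u v where "w = u @ Up # v" "count_list u Up = j"
        using Cons.IH by blast
      then show ?thesis
        using False by (intro exI[of _ "s # u"] exI[of _ v]) (auto simp: j_def)
    qed
  qed simp
  then show thesis using that by blast
qed

lemma step_height_append_Up: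
  assumes "walk 0 u h"
  shows "step_height (u @ Up # v) (length u) = int (Suc h)"
proof -
  have "path_point (u @ Up # v) (Suc (length u)) = path_point u (length u) + (1, 1)"
    by (simp add: path_point_def)
  then show ?thesis
    using assms by (simp add: step_height_def path_point_append_le walk_iff_path_point)
qed

text \<open>
  The union ranges over at most one height \<open>h\<close>. It is written in this way so that the case \<open>d = 0\<close>
  is included, where it is empty because an up-step has positive height.
\<close>

lemma up_step_count_decomp:
  assumes "i < n"
  shows "{w. dyck_path n w \<and> step_height w (up_step_pos w (Suc i)) = int d}
      = (\<lambda>(u, v). u @ Up # v) ` (\<Union>h\<in>{h. d = Suc h}. walks 0 i h \<times> walks d (n - Suc i) 0)"
    (is "?L = ?R")
proof (rule set_eqI)
  fix w
  show "w \<in> ?L \<longleftrightarrow> w \<in> ?R"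
  proof
    assume L: "w \<in> ?L"
    then have w: "walk 0 w 0" "count_list w Up = n"
      by (auto simp: dyck_path_iff_walk)
    obtain u v where uv: "w = u @ Up # v" "count_list u Up = i"
      using split_at_up_step[of i w] w assms by auto
    then obtain h where h: "walk 0 u h" "walk (Suc h) v 0"
      using w by (auto simp: walk_append)
    have "d = Suc h"
      using L uv up_step_pos_append[of u v] step_height_append_Up[OF h(1), of v] by simp
    moreover have "count_list v Up = n - Suc i"
      using w uv by simp
    ultimately show "w \<in> ?R"
      using uv h by (auto simp: walks_def)
  next
    assume "w \<in> ?R"
    then obtain u v h where uv: "w = u @ Up # v" "d = Suc h" "u \<in> walks 0 i h"
        "v \<in> walks d (n - Suc i) 0"
      by auto
    then have "walk 0 w 0" "count_list w Up = n"
      using assms by (auto simp: walks_def walk_append)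
    moreover have "step_height w (up_step_pos w (Suc i)) = int d"
      using uv up_step_pos_append[of u v] step_height_append_Up[of u h v] by (auto simp: walks_def)
    ultimately show "w \<in> ?L"
      by (simp add: dyck_path_iff_walk)
  qed
qed

lemma up_step_count_0: "i < n \<Longrightarrow> up_step_count (Suc i) 0 n = 0"
  unfolding up_step_count_def up_step_count_decomp by simp

text \<open>
  The cut is unique since the length of the first piece is the position of the up-step with index
  \<open>Suc i\<close>.
\<close>

lemma up_step_count_Suc:
  assumes "i < n"
  shows "up_step_count (Suc i) (Suc h) n
    = card (walks 0 i h) * card (walks (Suc h) (n - Suc i) 0)"
proof -
  have "inj_on (\<lambda>(u, v). u @ Up # v) (walks 0 i h \<times> walks (Suc h) (n - Suc i) 0)"
  proof (rule inj_onI, clarify)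
    fix u v u' v'
    assume uv: "u \<in> walks 0 i h" "u' \<in> walks 0 i h" "u @ Up # v = u' @ Up # v'"
    then have "length u = length u'"
      using up_step_pos_append[of u v] up_step_pos_append[of u' v'] by (simp add: walks_def)
    then show "u = u' \<and> v = v'"
      using uv by simp
  qed
  then show ?thesis
    unfolding up_step_count_def up_step_count_decomp[OF assms]
    by (simp add: card_image card_cartesian_product)
qed

section \<open>Series in one, two and three variables\<close>

text \<open>
  This is the series \<open>f(t z)\<close>, with the coefficients of \<open>f\<close> viewed as constants of a ring with one
  more variable, in which \<open>t\<close> lies. For \<open>t = 1\<close> it is the plain embedding, which lets two-variable
  series in \<open>x, z\<close> act on series in \<open>x, y, z\<close>; for \<open>t = fps_X\<close> it turns a series in \<open>z\<close> into one in
  \<open>x z\<close>.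
\<close>

definition dilate :: "'a::comm_ring_1 fps \<Rightarrow> 'a fps \<Rightarrow> 'a fps fps" where
  "dilate t f = Abs_fps (\<lambda>n. t ^ n * fps_const (f $ n))"

lemma dilate_nth: "dilate t f $ n = t ^ n * fps_const (f $ n)"
  by (simp add: dilate_def)

lemma dilate_1 [simp]: "dilate t 1 = 1"
  by (rule fps_ext) (simp add: dilate_nth)

lemma dilate_add: "dilate t (f + g) = dilate t f + dilate t g"
  by (rule fps_ext) (simp add: dilate_nth algebra_simps flip: fps_const_add)

lemma fps_const_sum: "fps_const (sum f A) = (\<Sum>i\<in>A. fps_const (f i))"
  by (rule fps_ext) (simp add: fps_sum_nth)

lemma dilate_mult: "dilate t (f * g) = dilate t f * dilate t g"
proof (rule fps_ext)
  fix n
  have "(dilate t f * dilate t g) $ n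
      = (\<Sum>i=0..n. t ^ i * fps_const (f $ i) * (t ^ (n - i) * fps_const (g $ (n - i))))"
    by (simp add: fps_mult_nth dilate_nth)
  also have "\<dots> = (\<Sum>i=0..n. t ^ n * fps_const (f $ i * g $ (n - i)))"
  proof (rule sum.cong)
    fix i assume "i \<in> {0..n}"
    then have "t ^ n = t ^ i * t ^ (n - i)"
      by (simp flip: power_add)
    then show "t ^ i * fps_const (f $ i) * (t ^ (n - i) * fps_const (g $ (n - i)))
        = t ^ n * fps_const (f $ i * g $ (n - i))"
      by (simp add: mult_ac flip: fps_const_mult)
  qed simp
  also have "\<dots> = t ^ n * fps_const ((f * g) $ n)"
    by (simp add: fps_mult_nth fps_const_sum flip: sum_distrib_left)
  finally show "dilate t (f * g) $ n = (dilate t f * dilate t g) $ n"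
    by (simp add: dilate_nth)
qed

lemma dilate_power: "dilate t (f ^ n) = dilate t f ^ n"
  by (induction n) (simp_all add: dilate_mult)

lemma C_Z: "C Z = dilate 1 (dilate 1 catalan_gf)"
  unfolding C_def Z_def fps_compose_fps_X
  by (rule fps_ext) (simp add: dilate_nth)

lemma X_times_Z: "X * Z = dilate 1 (dilate fps_X fps_X)"
  by (rule fps_ext) (simp add: X_def Z_def dilate_nth le_Suc_eq)

lemma C_XZ: "C (X * Z) = dilate 1 (dilate fps_X catalan_gf)"
  unfolding C_def X_def Z_def fps_compose_linear
  by (rule fps_ext) (simp add: dilate_nth fps_const_power flip: fps_const_mult)

text \<open>
  Since \<open>y\<close> is the middle one of the three nested variables, its coefficients are not directly
  accessible as coefficients of the outer series. A coefficient of \<open>y\<^sup>d\<close> is itself a series in the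
  two variables \<open>x\<close> and \<open>z\<close>, and multiplication by a series free of \<open>y\<close> acts on each of them
  separately.
\<close>

definition y_coeff :: "nat \<Rightarrow> fps3 \<Rightarrow> rat fps fps" where
  "y_coeff d F = Abs_fps (\<lambda>n. F $ n $ d)"

lemma fps3_eqI:
  assumes "\<And>d. y_coeff d F = y_coeff d G"
  shows "F = G"
  using assms by (auto simp: y_coeff_def fps_eq_iff)

lemma y_coeff_add: "y_coeff d (F + G) = y_coeff d F + y_coeff d G"
  by (rule fps_ext) (simp add: y_coeff_def)

lemma y_coeff_dilate_mult: "y_coeff d (dilate 1 G * F) = G * y_coeff d F"
  by (rule fps_ext) (simp add: y_coeff_def dilate_nth fps_mult_nth[of "dilate 1 G"] fps_mult_nth[of G] fps_sum_nth)

lemma y_coeff_dilate: "y_coeff d (dilate 1 G) = (if d = 0 then G else 0)"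
  by (rule fps_ext) (simp add: y_coeff_def dilate_nth)

lemma y_coeff_Y_mult: "y_coeff d (Y * F) = (if d = 0 then 0 else y_coeff (d - 1) F)"
  by (rule fps_ext) (simp add: y_coeff_def Y_def)

text \<open>
  In \<open>f(x z) g(z)\<close> the exponent of \<open>x\<close> records which part of \<open>z\<^sup>n\<close> comes from \<open>f\<close>, so the
  convolution has a single term.
\<close>

lemma dilate_mult_dilate_nth:
  fixes f g :: "'a::comm_ring_1 fps"
  shows "(dilate fps_X f * dilate 1 g) $ n $ r = (if r \<le> n then f $ r * g $ (n - r) else 0)"
proof -
  have "(dilate fps_X f * dilate 1 g) $ n $ r
      = (\<Sum>i=0..n. if i = r then f $ i * g $ (n - i) else 0)"
    unfolding fps_mult_nth[of "dilate fps_X f"] fps_sum_nth dilate_nth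
    by (rule sum.cong) (auto simp: mult.assoc fps_X_power_mult_nth)
  then show ?thesis by simp
qed

lemma y_coeff_U_0: "y_coeff 0 U = 0"
proof -
  have "up_step_count r 0 n = 0" if "1 \<le> r" "r \<le> n" for r n
    using up_step_count_0[of "r - 1" n] that by simp
  then show ?thesis
    by (intro fps_ext) (simp add: y_coeff_def U_def)
qed

text \<open>
  A cut at the up-step with index \<open>Suc i\<close> leaves \<open>i\<close> up-steps in front; the additional factor
  \<open>fps_X\<close> in the first series accounts for the cut step itself and makes the coefficient at index
  \<open>0\<close> vanish.
\<close>

lemma y_coeff_U_Suc:
  "y_coeff (Suc d) U
     = dilate fps_X (fps_X ^ Suc d * catalan_gf ^ Suc d) * dilate 1 (catalan_gf ^ Suc (Suc d))"
proof -
  have "(if 1 \<le> r \<and> r \<le> n then of_nat (up_step_count r (Suc d) n) else 0)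
      = (if r \<le> n then (fps_X * (fps_X ^ d * catalan_gf ^ Suc d)) $ r
           * (catalan_gf ^ Suc (Suc d)) $ (n - r) else 0)" for n r
  proof (cases r)
    case 0
    then show ?thesis by (simp add: fps_X_mult_nth)
  next
    case (Suc i)
    then show ?thesis
      using up_step_count_Suc[of i n d]
      by (simp add: fps_X_mult_nth card_walks_from_0 card_walks_to_0 Suc_le_eq del: power_Suc)
  qed
  then show ?thesis
    by (intro fps_ext)
       (simp only: y_coeff_def U_def fps_nth_Abs_fps dilate_mult_dilate_nth
         power_Suc[of fps_X] mult.assoc)
qed

text \<open>
  Compared at \<open>y\<^sup>d\<close>, the equation says that the coefficient of \<open>y\<close> in \<open>U\<close> is
  \<open>x z C(z)\<^sup>2 C(x z)\<close> and that each later coefficient is \<open>x z C(z) C(x z)\<close> times the preceding one.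
\<close>

lemma U_eq: "U = X * Y * Z * (C Z)\<^sup>2 * C (X * Z) + X * Y * Z * C Z * C (X * Z) * U"
proof (rule fps3_eqI)
  fix d
  let ?q = "dilate fps_X (fps_X * catalan_gf) * dilate 1 catalan_gf"
  have "X * Y * Z * (C Z)\<^sup>2 * C (X * Z) = Y * ((X * Z) * C (X * Z) * C Z * C Z)"
    by (simp only: power2_eq_square mult_ac)
  also have "\<dots> = Y * dilate 1 (?q * dilate 1 catalan_gf)"
    by (simp only: C_Z C_XZ) (simp only: X_times_Z dilate_mult)
  finally have m: "X * Y * Z * (C Z)\<^sup>2 * C (X * Z) = Y * dilate 1 (?q * dilate 1 catalan_gf)" .
  have "X * Y * Z * C Z * C (X * Z) * U = Y * (((X * Z) * C (X * Z) * C Z) * U)"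
    by (simp only: mult_ac)
  also have "\<dots> = Y * (dilate 1 ?q * U)"
    by (simp only: C_Z C_XZ) (simp only: X_times_Z dilate_mult)
  finally have q: "X * Y * Z * C Z * C (X * Z) * U = Y * (dilate 1 ?q * U)" .
  show "y_coeff d U = y_coeff d
      (X * Y * Z * (C Z)\<^sup>2 * C (X * Z) + X * Y * Z * C Z * C (X * Z) * U)"
  proof (cases d)
    case 0
    then show ?thesis
      unfolding m q by (simp add: y_coeff_add y_coeff_Y_mult y_coeff_U_0)
  next
    case (Suc e)
    have "y_coeff (Suc e) (Y * dilate 1 (?q * dilate 1 catalan_gf) + Y * (dilate 1 ?q * U))
        = (if e = 0 then ?q * dilate 1 catalan_gf else 0) + ?q * y_coeff e U"
      by (simp only: y_coeff_add y_coeff_Y_mult y_coeff_dilate y_coeff_dilate_mult) simp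
    also have "\<dots> = y_coeff (Suc e) U"
      by (cases e) (simp_all add: y_coeff_U_0 y_coeff_U_Suc dilate_mult dilate_power mult_ac)
    finally show ?thesis
      unfolding m q Suc by (rule sym)
  qed
qed

lemma C_XZ_eq: "C (X * Z) = 1 + X * Z * (C (X * Z))\<^sup>2"
proof -
  have "dilate 1 (dilate fps_X catalan_gf)
      = dilate 1 (dilate fps_X (1 + fps_X * catalan_gf ^ 2))"
    using catalan_gf_eq by simp
  then show ?thesis
    unfolding C_XZ by (simp add: X_times_Z dilate_add dilate_mult dilate_power)
qed

theorem theorem3p4:
  shows "U = (X * Y * Z * (C Z)\<^sup>2) / (1 - X * Z * (Y * C Z + C (X * Z)))
       \<and> (X * Y * Z * (C Z)\<^sup>2) / (1 - X * Z * (Y * C Z + C (X * Z)))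
           = (X * Y * Z * (C Z)\<^sup>2 * C (X * Z)) / (1 - X * Y * Z * C Z * C (X * Z))"
proof -
  let ?k = "C (X * Z)"
  let ?M = "X * Y * Z * (C Z)\<^sup>2"
  let ?D1 = "1 - X * Z * (Y * C Z + ?k)"
  let ?D2 = "1 - X * Y * Z * C Z * ?k"
  have D2: "?M * ?k = U * ?D2"
    using U_eq by (simp add: algebra_simps)
  have kD1: "?k * ?D1 = ?D2"
  proof -
    have "?k * ?D1 = ?k - X * Z * ?k\<^sup>2 - X * Y * Z * C Z * ?k"
      by (simp add: algebra_simps power2_eq_square)
    also have "?k - X * Z * ?k\<^sup>2 = 1"
      using C_XZ_eq by (metis add_diff_cancel_right')
    finally show ?thesis .
  qed
  have k_nz: "?k \<noteq> 0"
    using C_XZ_eq by force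
  have "?k * ?M = ?k * (U * ?D1)"
    using D2 unfolding kD1[symmetric] by (simp only: mult_ac)
  then have D1: "?M = U * ?D1"
    using k_nz by (simp only: mult_cancel_left) simp
  have c1: "?D1 $ 0 = 1" and c2: "?D2 $ 0 = 1"
    by (simp_all add: Z_def)
  have "?M / ?D1 = U"
    using fps3_divide_eq_iff[OF c1] D1 by blast
  moreover have "?M * ?k / ?D2 = U"
    using fps3_divide_eq_iff[OF c2] D2 by blast
  ultimately show ?thesis by simp
qed

end
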